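(* Let $(X,\tau)$ be an ultrametrizable topological space with $\operatorname{card} X\geq 2$. Then the following conditions are equivalent: (i) For every ultrametric $d$ on $X$ compatible with $\tau$, there is an integer $k=k(d)$ such that the diametrical graph $G_{X,d}$ is complete $k$-partite. (ii) For every ultrametric $d$ on $X$ compatible with $\tau$, the diametrical graph $G_{X,d}$ is complete multipartite. (iii) The topological space $(X,\tau)$ is compact.
   Context: An ultrametric on $X$ is a metric $d$ with $d(x,y)\leq\max\{d(x,z),d(z,y)\}$ for all $x,y,z\in X$. A topology $\tau$ and an ultrametric $d$ on $X$ are compatible if the set of all open balls $B_r(c)=\{x\in X:d(c,x)<r\}$, $c\in X$, $r>0$, is an open base for $\tau$. The space $(X,\tau)$ is ultrametrizable if there is an ultrametric on $X$ compatible with $\tau$. Compact means every open cover has a finite subcover. Graphs are simple: a graph $G=(V,E)$ consists of a nonempty set $V=V(G)$ of arbitrary cardinality and a set $E=E(G)$ of unordered pairs of distinct points of $V$. For a cardinal number $k\geq 2$, $G$ is complete $k$-partite if $V(G)$ can be partitioned into $k$ nonempty disjoint subsets (parts) such that no edge has both ends in the same part and any two vertices in different parts are adjacent; $G$ is complete multipartite if it is complete $k$-partite for some cardinal $k\geq 2$ (finite or infinite). With $\operatorname{diam} X=\sup\{d(x,y): x,y\in X\}\in[0,\infty]$, the diametrical graph $G_{X,d}$ is the graph with vertex set $X$ in which $\{u,v\}$ is an edge iff $u\neq v$ and $d(u,v)=\operatorname{diam} X$. *)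

theory Defs
  imports "HOL-Analysis.Analysis"
begin

unbundle cardinal_syntax

text \<open>
  \<^term>\<open>Metric_space M d\<close> asks for nonnegativity and symmetry of \<open>d\<close> also outside \<open>M\<close>. This is
  harmless: a metric on \<open>M\<close> extends by \<open>0\<close> to such a \<open>d\<close>, and everything below depends only on
  the values of \<open>d\<close> on \<open>M\<close>.
\<close>

locale Ultrametric_space = Metric_space +
  assumes ultra: "\<And>x y z. \<lbrakk>x \<in> M; y \<in> M; z \<in> M\<rbrakk> \<Longrightarrow> d x y \<le> max (d x z) (d z y)"

definition is_open_base :: "'a topology \<Rightarrow> 'a set set \<Rightarrow> bool" where
  "is_open_base T \<B> \<longleftrightarrow> (\<forall>U. openin T U \<longleftrightarrow> (\<exists>\<C>\<subseteq>\<B>. U = \<Union>\<C>))"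

definition compatible :: "'a topology \<Rightarrow> ('a \<Rightarrow> 'a \<Rightarrow> real) \<Rightarrow> bool" where
  "compatible T d \<longleftrightarrow>
     is_open_base T {Metric_space.mball (topspace T) d c r | c r. c \<in> topspace T \<and> r > 0}"

definition ultrametrizable :: "'a topology \<Rightarrow> bool" where
  "ultrametrizable T \<longleftrightarrow> (\<exists>d. Ultrametric_space (topspace T) d \<and> compatible T d)"

type_synonym 'v graph = "'v set \<times> 'v set set"

abbreviation verts :: "'v graph \<Rightarrow> 'v set" where "verts G \<equiv> fst G"
abbreviation edges :: "'v graph \<Rightarrow> 'v set set" where "edges G \<equiv> snd G"

definition simple_graph :: "'v graph \<Rightarrow> bool" where
  "simple_graph G \<longleftrightarrow>
     verts G \<noteq> {} \<and> edges G \<subseteq> {{u, v} | u v. u \<in> verts G \<and> v \<in> verts G \<and> u \<noteq> v}"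

definition complete_partite :: "'k rel \<Rightarrow> 'v graph \<Rightarrow> bool" where
  "complete_partite k G \<longleftrightarrow>
     simple_graph G \<and> Card_order k \<and> |{..<2::nat}| \<le>o k \<and>
     (\<exists>P. partition_on (verts G) P \<and> |P| =o k \<and>
          (\<forall>A\<in>P. \<forall>u\<in>A. \<forall>v\<in>A. {u, v} \<notin> edges G) \<and>
          (\<forall>A\<in>P. \<forall>B\<in>P. A \<noteq> B \<longrightarrow> (\<forall>u\<in>A. \<forall>v\<in>B. {u, v} \<in> edges G)))"

text \<open>
  The number of parts of a graph is the cardinality of a set of subsets of vertices, so letting
  \<open>k\<close> range over the cardinals on the type \<^typ>\<open>'v set\<close> loses no cardinal number.
\<close>

definition complete_multipartite :: "'v graph \<Rightarrow> bool" where
  "complete_multipartite G \<longleftrightarrow> (\<exists>k :: 'v set rel. complete_partite k G)"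

definition diam :: "'a set \<Rightarrow> ('a \<Rightarrow> 'a \<Rightarrow> real) \<Rightarrow> ennreal" where
  "diam X d = (SUP (x, y) \<in> X \<times> X. ennreal (d x y))"

definition diametrical_graph :: "'a set \<Rightarrow> ('a \<Rightarrow> 'a \<Rightarrow> real) \<Rightarrow> 'a graph" where
  "diametrical_graph X d =
     (X, {{u, v} | u v. u \<in> X \<and> v \<in> X \<and> u \<noteq> v \<and> ennreal (d u v) = diam X d})"

lemma simple_graph_diametrical_graph:
  "X \<noteq> {} \<Longrightarrow> simple_graph (diametrical_graph X d)"
  by (auto simp: simple_graph_def diametrical_graph_def)

end

theory Submission
  imports Defs
begin

text \<open>
  In a totally bounded ultrametric space the diameter \<open>D\<close> is attained, and the parts of the
  diametrical graph are the finitely many open balls of radius \<open>D\<close>. If the space is not compact,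
  it carries an unbounded locally constant function \<open>f\<close> to the natural numbers: either there are
  infinitely many balls of some radius, and they can be numbered, or there is a Cauchy sequence
  without limit, and the inverse of the distance to its missing limit point is locally constant.
  Raising \<open>d x y\<close> to at least \<open>max (f x) (f y)\<close> whenever \<open>f x \<noteq> f y\<close> does not change the
  topology, but makes the diameter infinite, so that the diametrical graph has no edges.
\<close>

section \<open>Complete multipartite graphs and the number of their parts\<close>

lemma two_le_card_iff: "|{..<2::nat}| \<le>o |A| \<longleftrightarrow> (\<exists>a\<in>A. \<exists>b\<in>A. a \<noteq> b)"
proof
  assume "|{..<2::nat}| \<le>o |A|"
  then obtain f where "inj_on f {..<2::nat}" "f ` {..<2::nat} \<subseteq> A"
    unfolding card_of_ordLeq[symmetric] by blast
  then have "f 0 \<in> A" "f 1 \<in> A" "f 0 \<noteq> f 1"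
    by (auto dest: inj_onD)
  then show "\<exists>a\<in>A. \<exists>b\<in>A. a \<noteq> b"
    by blast
next
  assume "\<exists>a\<in>A. \<exists>b\<in>A. a \<noteq> b"
  then obtain a b where "a \<in> A" "b \<in> A" "a \<noteq> b"
    by blast
  then have "inj_on (\<lambda>n::nat. if n = 0 then a else b) {..<2}"
    "(\<lambda>n::nat. if n = 0 then a else b) ` {..<2} \<subseteq> A"
    by (auto simp: inj_on_def)
  then show "|{..<2::nat}| \<le>o |A|"
    unfolding card_of_ordLeq[symmetric] by blast
qed

text \<open>The cardinal \<open>k\<close> may live on any type, here later on the natural numbers,
  while \<open>complete_multipartite\<close> asks for one on sets of vertices. The cardinal
  \<open>|P|\<close> of the partition itself has the required type.\<close>

lemma complete_partite_imp_multipartite: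
  assumes "complete_partite k G"
  shows "complete_multipartite G"
proof -
  obtain P where P: "partition_on (verts G) P" "|P| =o k"
    "\<forall>A\<in>P. \<forall>u\<in>A. \<forall>v\<in>A. {u, v} \<notin> edges G"
    "\<forall>A\<in>P. \<forall>B\<in>P. A \<noteq> B \<longrightarrow> (\<forall>u\<in>A. \<forall>v\<in>B. {u, v} \<in> edges G)"
    and "simple_graph G" "|{..<2::nat}| \<le>o k"
    using assms unfolding complete_partite_def by blast
  moreover have "|{..<2::nat}| \<le>o |P|"
    using \<open>|{..<2::nat}| \<le>o k\<close> \<open>|P| =o k\<close> ordIso_symmetric ordLeq_ordIso_trans by blast
  ultimately have "complete_partite |P| G"
    unfolding complete_partite_def
    by (intro conjI exI[of _ P]) (assumption | rule card_of_Card_order card_of_refl)+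
  then show ?thesis
    unfolding complete_multipartite_def by blast
qed

lemma complete_multipartite_edge:
  assumes "complete_multipartite G"
  obtains u v where "{u, v} \<in> edges G"
proof -
  obtain k :: "'a set rel" and P where P: "partition_on (verts G) P" "|P| =o k"
    "\<forall>A\<in>P. \<forall>B\<in>P. A \<noteq> B \<longrightarrow> (\<forall>u\<in>A. \<forall>v\<in>B. {u, v} \<in> edges G)"
    and "|{..<2::nat}| \<le>o k"
    using assms unfolding complete_multipartite_def complete_partite_def by (elim exE conjE)
  have "|{..<2::nat}| \<le>o |P|"
    using \<open>|{..<2::nat}| \<le>o k\<close> \<open>|P| =o k\<close> ordIso_symmetric ordLeq_ordIso_trans by blast
  then obtain A B where AB: "A \<in> P" "B \<in> P" "A \<noteq> B"
    unfolding two_le_card_iff by blast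
  then obtain u v where "u \<in> A" "v \<in> B"
    using P(1) unfolding partition_on_def by (metis ex_in_conv)
  then show thesis
    using P(3) AB that by blast
qed

section \<open>Compatible metrics and the edges of the diametrical graph\<close>

text \<open>A base determines its topology, and a metrically open set is the union of the balls that
  it contains.\<close>

lemma (in Metric_space) compatible_iff:
  assumes "topspace T = M"
  shows "compatible T d \<longleftrightarrow> T = mtopology"
proof -
  let ?B = "{mball c r | c r. c \<in> M \<and> r > 0}"
  have "openin mtopology U \<longleftrightarrow> (\<exists>\<C>\<subseteq>?B. U = \<Union>\<C>)" for U
  proof
    assume U: "openin mtopology U"
    have "U = \<Union>{V \<in> ?B. V \<subseteq> U}"
    proof (intro equalityI subsetI)
      fix x assume x: "x \<in> U"
      with U obtain r where "x \<in> M" "r > 0" "mball x r \<subseteq> U"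
        unfolding openin_mtopology by blast
      then show "x \<in> \<Union>{V \<in> ?B. V \<subseteq> U}"
        using centre_in_mball_iff by blast
    qed blast
    then show "\<exists>\<C>\<subseteq>?B. U = \<Union>\<C>"
      by (intro exI[of _ "{V \<in> ?B. V \<subseteq> U}"] conjI) auto
  next
    assume "\<exists>\<C>\<subseteq>?B. U = \<Union>\<C>"
    then show "openin mtopology U"
      by (auto intro!: openin_Union)
  qed
  then show ?thesis
    unfolding compatible_def is_open_base_def assms topology_eq by auto
qed

text \<open>The value \<open>ennreal (d u v)\<close> is finite and is one of the terms of the
  supremum, so equality says that the supremum is attained at this pair. An unbounded metric
  therefore yields no edges.\<close>

lemma (in Metric_space) diametrical_graph_edge_iff:
  "{u, v} \<in> edges (diametrical_graph M d) \<longleftrightarrow>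
     u \<in> M \<and> v \<in> M \<and> u \<noteq> v \<and> (\<forall>x\<in>M. \<forall>y\<in>M. d x y \<le> d u v)"
proof -
  have "ennreal (d u v) = diam M d \<longleftrightarrow> (\<forall>x\<in>M. \<forall>y\<in>M. d x y \<le> d u v)"
    if "u \<in> M" "v \<in> M" for u v
  proof -
    have "ennreal (d u v) \<le> diam M d"
      unfolding diam_def using that by (intro SUP_upper2[of "(u, v)"]) auto
    moreover have "diam M d \<le> ennreal (d u v) \<longleftrightarrow> (\<forall>x\<in>M. \<forall>y\<in>M. d x y \<le> d u v)"
      unfolding diam_def by (auto simp: SUP_le_iff)
    ultimately show ?thesis
      by (metis order_antisym order_refl)
  qed
  then show ?thesis
    unfolding diametrical_graph_def by (auto simp: doubleton_eq_iff commute)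
qed

lemma (in Metric_space) mtotally_boundedE:
  assumes "mtotally_bounded S" "\<epsilon> > 0"
  obtains K where "finite K" "K \<subseteq> S" "S \<subseteq> (\<Union>x\<in>K. mball x \<epsilon>)"
  using assms(1)[unfolded mtotally_bounded_def, rule_format, OF assms(2)] by (elim exE conjE)

section \<open>Balls and diameter in a totally bounded ultrametric space\<close>

context Ultrametric_space
begin

text \<open>Isosceles triangle principle: the two longest sides of a triangle agree, as neither can
  exceed the maximum of the other two sides.\<close>

lemma ultra_eq:
  assumes "x \<in> M" "y \<in> M" "z \<in> M" "d x y < d x z"
  shows "d y z = d x z"
  using ultra[of y z x] ultra[of x z y] assms commute[of x y] by auto

text \<open>Every point of a ball is a centre of it, so the balls of a fixed positive radius
  partition the space.\<close>

lemma mball_eq: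
  assumes "x \<in> mball y r"
  shows "mball x r = mball y r"
proof -
  have *: "mball x r \<subseteq> mball y r" if "x \<in> mball y r" for x y
  proof
    fix z assume "z \<in> mball x r"
    then show "z \<in> mball y r"
      using that ultra[of y z x] by auto
  qed
  show ?thesis
    using *[of x y] *[of y x] assms by (auto simp: commute)
qed

text \<open>Cover the space by finitely many balls of radius \<open>d a c\<close> and let
  \<open>b\<close> be a centre farthest from \<open>a\<close>. Passing through centres bounds all
  distances from \<open>a\<close> by \<open>d a b\<close>; passing through \<open>a\<close> then
  bounds all distances.\<close>

lemma diameter_attained:
  assumes "mtotally_bounded M" "a \<in> M" "c \<in> M" "a \<noteq> c"
  obtains b where "b \<in> M" "a \<noteq> b" "\<And>x y. \<lbrakk>x \<in> M; y \<in> M\<rbrakk> \<Longrightarrow> d x y \<le> d a b"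
proof -
  have pos: "0 < d a c"
    using assms mdist_pos_less by blast
  obtain K where K: "finite K" "K \<subseteq> M" "M \<subseteq> (\<Union>x\<in>K. mball x (d a c))"
    using mtotally_boundedE[OF assms(1) pos] .
  then have "K \<noteq> {}"
    using assms(2) by auto
  then have "Max (d a ` K) \<in> d a ` K"
    using K(1) by (intro Max_in) auto
  then obtain b where b: "b \<in> K" "d a b = Max (d a ` K)"
    by auto
  then have le_K: "d a k \<le> d a b" if "k \<in> K" for k
    using K(1) that by simp
  have le: "d a x \<le> max (d a b) (d a c)" if x: "x \<in> M" for x
  proof -
    obtain k where "k \<in> K" "d k x < d a c"
      using K(3) x by auto
    then show ?thesis
      using le_K[of k] ultra[of a x k] assms x K(2) by fastforce
  qed
  \<comment> \<open>As \<open>d k c\<close> is strictly below \<open>d a c\<close>, the ultrametric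
    inequality leaves only \<open>d a c\<close> \<le> \<open>d a k\<close>.\<close>
  have "d a c \<le> d a b"
  proof -
    obtain k where "k \<in> K" "d k c < d a c"
      using K(3) assms(3) by auto
    then show ?thesis
      using le_K[of k] ultra[of a c k] assms K(2) by fastforce
  qed
  with le have le_a: "d a x \<le> d a b" if "x \<in> M" for x
    using that by fastforce
  show thesis
  proof
    show "b \<in> M"
      using b K by blast
    show "a \<noteq> b"
      using \<open>d a c \<le> d a b\<close> pos assms(2) by auto
    show "d x y \<le> d a b" if "x \<in> M" "y \<in> M" for x y
      using ultra[of x y a] le_a[of x] le_a[of y] that assms(2) commute[of x a] by auto
  qed
qed

text \<open>Points of one open ball of radius \<open>d a b\<close> are closer than
  \<open>d a b\<close>; points of different balls are at least, hence by maximality exactly, that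
  far apart.\<close>

lemma complete_partite_diametrical_graph:
  assumes "mtotally_bounded M" "a \<in> M" "c \<in> M" "a \<noteq> c"
  shows "\<exists>k::nat. complete_partite |{..<k}| (diametrical_graph M d)"
proof -
  obtain b where b: "b \<in> M" "a \<noteq> b" and le: "\<And>x y. \<lbrakk>x \<in> M; y \<in> M\<rbrakk> \<Longrightarrow> d x y \<le> d a b"
    using diameter_attained[OF assms] by blast
  define P where "P = (\<lambda>x. mball x (d a b)) ` M"
  have pos: "0 < d a b"
    using assms b mdist_pos_less by blast
  have edge: "{u, v} \<in> edges (diametrical_graph M d) \<longleftrightarrow> u \<in> M \<and> v \<in> M \<and> d u v = d a b" for u v
    unfolding diametrical_graph_edge_iff
    using le pos assms(2) b(1) by (metis less_irrefl order_antisym zero)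
  have ball: "mball x (d a b) = A" if "A \<in> P" "x \<in> A" for x A
    using that mball_eq unfolding P_def by blast
  obtain K where K: "finite K" "K \<subseteq> M" "M \<subseteq> (\<Union>x\<in>K. mball x (d a b))"
    using mtotally_boundedE[OF assms(1) pos] .
  \<comment> \<open>Any ball can be recentred at a point of the finite net, so the number of parts
    is finite.\<close>
  have "P \<subseteq> (\<lambda>x. mball x (d a b)) ` K"
  proof
    fix A assume "A \<in> P"
    then obtain x where x: "x \<in> M" "A = mball x (d a b)"
      unfolding P_def by blast
    then obtain k where k: "k \<in> K" "x \<in> mball k (d a b)"
      using K(3) by blast
    show "A \<in> (\<lambda>x. mball x (d a b)) ` K"
      using mball_eq[OF k(2)] k(1) x(2) by blast
  qed
  then have "finite P"
    using K(1) finite_surj by blast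
  then obtain f where "bij_betw f P {..<card P}"
    using ex_bij_betw_finite_nat unfolding lessThan_atLeast0 by blast
  then have iso: "|P| =o |{..<card P}|"
    using card_of_ordIso by blast
  have part: "partition_on M P"
  proof (rule partition_onI)
    show "\<Union>P = M"
      unfolding P_def using pos by auto
    show "{} \<notin> P"
      unfolding P_def using pos centre_in_mball_iff by blast
    show "disjnt A B" if "A \<in> P" "B \<in> P" "A \<noteq> B" for A B
      using that ball unfolding disjnt_iff by blast
  qed
  \<comment> \<open>The point \<open>b\<close> lies in its own ball but not in the open ball around
    \<open>a\<close>.\<close>
  have "mball a (d a b) \<in> P" "mball b (d a b) \<in> P" "mball a (d a b) \<noteq> mball b (d a b)"
    unfolding P_def using assms(2) b(1) pos centre_in_mball_iff[of b "d a b"] by auto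
  then have "|{..<2::nat}| \<le>o |P|"
    unfolding two_le_card_iff by blast
  then have two: "|{..<2::nat}| \<le>o |{..<card P}|"
    using iso ordLeq_ordIso_trans by blast
  have noedge: "{u, v} \<notin> edges (diametrical_graph M d)" if "A \<in> P" "u \<in> A" "v \<in> A" for A u v
    using ball[OF that(1,2)] that(3) edge by auto
  have all_edges: "{u, v} \<in> edges (diametrical_graph M d)"
    if "A \<in> P" "B \<in> P" "A \<noteq> B" "u \<in> A" "v \<in> B" for A B u v
  proof -
    have uv: "u \<in> M" "v \<in> M"
      using that part unfolding partition_on_def by blast+
    have "v \<notin> mball u (d a b)"
      using that ball by blast
    then show ?thesis
      using uv le[of u v] edge by auto
  qed
  have simple: "simple_graph (diametrical_graph M d)"
    using assms(2) by (intro simple_graph_diametrical_graph) auto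
  have verts: "verts (diametrical_graph M d) = M"
    by (simp add: diametrical_graph_def)
  have "complete_partite |{..<card P}| (diametrical_graph M d)"
    unfolding complete_partite_def verts
    by (intro conjI exI[of _ P] ballI impI simple card_of_Card_order two part iso)
      (fact noedge all_edges)+
  then show ?thesis
    by blast
qed

section \<open>Unbounded locally constant functions on noncompact spaces\<close>

lemma unbounded_locally_constant_if_not_mtotally_bounded:
  assumes "\<not> mtotally_bounded M"
  obtains f :: "'a \<Rightarrow> nat" where
    "\<And>x. x \<in> M \<Longrightarrow> \<exists>r>0. \<forall>y \<in> mball x r. f y = f x" "\<And>n. \<exists>x\<in>M. n \<le> f x"
proof -
  obtain \<epsilon> where \<epsilon>: "\<epsilon> > 0" "\<And>K. \<lbrakk>finite K; K \<subseteq> M\<rbrakk> \<Longrightarrow> \<not> M \<subseteq> (\<Union>x\<in>K. mball x \<epsilon>)"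
    using assms unfolding mtotally_bounded_def by (simp only: not_all not_imp not_ex) metis
  define B where "B = (\<lambda>x. mball x \<epsilon>) ` M"
  \<comment> \<open>Otherwise one centre from each ball would give a finite net.\<close>
  have "infinite B"
  proof
    assume "finite B"
    then obtain K where K: "K \<subseteq> M" "finite K" "B = (\<lambda>x. mball x \<epsilon>) ` K"
      unfolding B_def using finite_subset_image[of "(\<lambda>x. mball x \<epsilon>) ` M" "\<lambda>x. mball x \<epsilon>" M] by blast
    have "M \<subseteq> \<Union>B"
      unfolding B_def using \<epsilon>(1) by auto
    then show False
      using K \<epsilon>(2) by blast
  qed
  then obtain g :: "nat \<Rightarrow> 'a set" where g: "inj g" "range g \<subseteq> B"
    using infinite_countable_subset by blast
  show thesis
  proof
    \<comment> \<open>Off the range of \<open>g\<close> the value of \<open>inv g\<close> is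
      unspecified, but it still depends only on the ball around the point, which is the same for all
      points of that ball.\<close>
    show "\<exists>r>0. \<forall>y \<in> mball x r. inv g (mball y \<epsilon>) = inv g (mball x \<epsilon>)" if "x \<in> M" for x
      using \<epsilon>(1) mball_eq by metis
    show "\<exists>x\<in>M. n \<le> inv g (mball x \<epsilon>)" for n
    proof -
      obtain x where "x \<in> M" "g n = mball x \<epsilon>"
        using g(2) unfolding B_def by blast
      then show ?thesis
        using g(1) by (metis inv_f_f order_refl)
    qed
  qed
qed

text \<open>\<open>L x\<close> plays the distance from \<open>x\<close> to the missing limit. It is
  positive because there is no limit, and it takes arbitrarily small values along the
  sequence.\<close>

lemma unbounded_locally_constant_if_not_mcomplete:
  assumes "\<not> mcomplete"
  obtains f :: "'a \<Rightarrow> nat" where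
    "\<And>x. x \<in> M \<Longrightarrow> \<exists>r>0. \<forall>y \<in> mball x r. f y = f x" "\<And>n. \<exists>x\<in>M. n \<le> f x"
proof -
  obtain \<sigma> where "MCauchy \<sigma>" and nolim: "\<And>x. \<not> limitin mtopology \<sigma> x sequentially"
    using assms unfolding mcomplete_def by blast
  then have \<sigma>M: "\<And>n. \<sigma> n \<in> M"
    and Cauchy: "\<And>\<epsilon>. \<epsilon> > 0 \<Longrightarrow> \<exists>N. \<forall>n n'. N \<le> n \<longrightarrow> N \<le> n' \<longrightarrow> d (\<sigma> n) (\<sigma> n') < \<epsilon>"
    unfolding MCauchy_def by auto
  define L where "L x = lim (\<lambda>n. d x (\<sigma> n))" for x
  have L: "(\<lambda>n. d x (\<sigma> n)) \<longlonglongrightarrow> L x" if x: "x \<in> M" for x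
  proof -
    have "Cauchy (\<lambda>n. d x (\<sigma> n))"
      unfolding Cauchy_def dist_real_def
    proof (intro allI impI)
      fix e :: real assume "e > 0"
      then obtain N where N: "\<forall>n n'. N \<le> n \<longrightarrow> N \<le> n' \<longrightarrow> d (\<sigma> n) (\<sigma> n') < e"
        using Cauchy by blast
      have "\<bar>d x (\<sigma> m) - d x (\<sigma> n)\<bar> < e" if "m \<ge> N" "n \<ge> N" for m n
      proof -
        have "\<bar>d (\<sigma> m) x - d x (\<sigma> n)\<bar> \<le> d (\<sigma> m) (\<sigma> n)"
          using mdist_reverse_triangle \<sigma>M x by blast
        then show ?thesis
          using N that commute[of x "\<sigma> m"] by fastforce
      qed
      then show "\<exists>N. \<forall>m\<ge>N. \<forall>n\<ge>N. \<bar>d x (\<sigma> m) - d x (\<sigma> n)\<bar> < e"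
        by blast
    qed
    then show ?thesis
      unfolding L_def by (simp add: Cauchy_convergent_iff convergent_LIMSEQ_iff)
  qed
  have pos: "L x > 0" if x: "x \<in> M" for x
  proof -
    have "L x \<ge> 0"
      using L[OF x] by (rule LIMSEQ_le_const) auto
    moreover have "L x \<noteq> 0"
    proof
      assume "L x = 0"
      then have "limitin mtopology \<sigma> x sequentially"
        using L[OF x] x \<sigma>M by (simp add: limitin_metric_dist_null commute)
      then show False
        using nolim by blast
    qed
    ultimately show ?thesis
      by simp
  qed
  \<comment> \<open>Eventually \<open>d x y\<close> is less than \<open>d x (\<sigma> n)\<close>,
    and the isosceles principle makes the distances from \<open>x\<close> and from \<open>y\<close>
    to \<open>\<sigma> n\<close> equal.\<close>
  have const: "L y = L x" if x: "x \<in> M" and y: "y \<in> mball x (L x)" for x y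
  proof -
    have "\<forall>\<^sub>F n in sequentially. d x y < d x (\<sigma> n)"
      using order_tendstoD(1)[OF L[OF x]] y by simp
    then have "\<forall>\<^sub>F n in sequentially. d x (\<sigma> n) = d y (\<sigma> n)"
    proof (rule eventually_mono)
      fix n assume "d x y < d x (\<sigma> n)"
      then show "d x (\<sigma> n) = d y (\<sigma> n)"
        using ultra_eq[OF x _ \<sigma>M] y by simp
    qed
    then have "(\<lambda>n. d y (\<sigma> n)) \<longlonglongrightarrow> L x"
      by (rule Lim_transform_eventually[OF L[OF x]])
    moreover have "(\<lambda>n. d y (\<sigma> n)) \<longlonglongrightarrow> L y"
      using L y by simp
    ultimately show ?thesis
      using LIMSEQ_unique by blast
  qed
  show thesis
  proof
    show "\<exists>r>0. \<forall>y \<in> mball x r. nat \<lfloor>1 / L y\<rfloor> = nat \<lfloor>1 / L x\<rfloor>" if "x \<in> M" for x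
      using that pos const by metis
    show "\<exists>x\<in>M. n \<le> nat \<lfloor>1 / L x\<rfloor>" for n :: nat
    proof -
      \<comment> \<open>The summand 1 keeps the bound positive and finite for
        \<open>n = 0\<close>.\<close>
      obtain N where N: "\<And>m. N \<le> m \<Longrightarrow> d (\<sigma> N) (\<sigma> m) < 1 / (real n + 1)"
        using Cauchy[of "1 / (real n + 1)"] by auto
      have "L (\<sigma> N) \<le> 1 / (real n + 1)"
        using L[OF \<sigma>M] by (rule LIMSEQ_le_const2) (use N less_imp_le in blast)
      then have "real n \<le> 1 / L (\<sigma> N)"
        using pos[OF \<sigma>M[of N]] by (simp add: field_simps)
      then have "n \<le> nat \<lfloor>1 / L (\<sigma> N)\<rfloor>"
        by (simp add: le_nat_floor)
      then show ?thesis
        using \<sigma>M by blast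
    qed
  qed
qed

section \<open>An unbounded ultrametric with the same topology\<close>

lemma unbounded_ultrametric_if_not_compact:
  assumes "\<not> compact_space mtopology"
  obtains e where "Ultrametric_space M e" "Metric_space.mtopology M e = mtopology"
    "\<And>n::nat. \<exists>x\<in>M. \<exists>y\<in>M. real n \<le> e x y"
proof -
  have "\<not> mtotally_bounded M \<or> \<not> mcomplete"
    using assms compact_space_eq_mcomplete_mtotally_bounded by blast
  then obtain f :: "'a \<Rightarrow> nat" where
    f: "\<And>x. x \<in> M \<Longrightarrow> \<exists>r>0. \<forall>y \<in> mball x r. f y = f x" "\<And>n. \<exists>x\<in>M. n \<le> f x"
    using unbounded_locally_constant_if_not_mtotally_bounded
      unbounded_locally_constant_if_not_mcomplete by metis
  define g where "g x y = (if f x = f y then 0 else real (max (f x) (f y)))" for x y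
  define e where "e x y = max (d x y) (g x y)" for x y
  \<comment> \<open>Let \<open>f x\<close> and \<open>f y\<close> differ and consider the endpoint
    with the larger value. If \<open>f z\<close> differs from that value, the side from this
    endpoint to \<open>z\<close> is long enough; otherwise \<open>z\<close> can replace the
    endpoint.\<close>
  have g_ultra: "g x y \<le> max (g x z) (g z y)" for x y z
    unfolding g_def by auto
  have e_ultra: "e x y \<le> max (e x z) (e z y)" if "x \<in> M" "y \<in> M" "z \<in> M" for x y z
    using ultra[OF that] g_ultra[of x y z] unfolding e_def by linarith
  have e_nonneg: "0 \<le> e x y" for x y
    unfolding e_def using nonneg[of x y] by linarith
  interpret E: Ultrametric_space M e
  proof
    show "e x y = 0 \<longleftrightarrow> x = y" if "x \<in> M" "y \<in> M" for x y
    proof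
      assume "e x y = 0"
      then have "d x y \<le> 0"
        unfolding e_def by linarith
      then show "x = y"
        using that nonneg[of x y] by simp
    next
      assume "x = y"
      then show "e x y = 0"
        using that unfolding e_def g_def by simp
    qed
    show "e x z \<le> e x y + e y z" if "x \<in> M" "y \<in> M" "z \<in> M" for x y z
      using e_ultra[of x z y] e_nonneg[of x y] e_nonneg[of y z] that by linarith
    show "e x y = e y x" for x y
      unfolding e_def g_def using commute[of x y] by (simp add: max.commute)
  qed (fact e_nonneg e_ultra)+
  have "openin E.mtopology U \<longleftrightarrow> openin mtopology U" for U
  proof
    assume U: "openin E.mtopology U"
    show "openin mtopology U"
      unfolding openin_mtopology
    proof (intro conjI allI impI)
      show "U \<subseteq> M"
        using U unfolding E.openin_mtopology by blast
      fix x assume "x \<in> U"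
      then obtain r where r: "r > 0" "E.mball x r \<subseteq> U" and x: "x \<in> M"
        using U unfolding E.openin_mtopology by blast
      obtain s where s: "s > 0" "\<forall>y \<in> mball x s. f y = f x"
        using f(1) x by blast
      \<comment> \<open>Within distance \<open>s\<close> of \<open>x\<close> the function
        \<open>f\<close> is constant, so there \<open>g\<close> vanishes and \<open>e\<close> agrees
        with \<open>d\<close>.\<close>
      have "mball x (min r s) \<subseteq> E.mball x r"
      proof
        fix y assume y: "y \<in> mball x (min r s)"
        then have "f y = f x"
          using s(2) by simp
        then have "e x y = d x y"
          unfolding e_def g_def by simp
        then show "y \<in> E.mball x r"
          using y by simp
      qed
      then show "\<exists>r>0. mball x r \<subseteq> U"
        using r s(1) by (intro exI[of _ "min r s"] conjI) (simp, rule order_trans)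
    qed
  next
    assume U: "openin mtopology U"
    have "E.mball x r \<subseteq> mball x r" for x r
      by (auto simp: e_def)
    then show "openin E.mtopology U"
      using U unfolding openin_mtopology E.openin_mtopology by (meson order_trans)
  qed
  then have "E.mtopology = mtopology"
    by (simp add: topology_eq)
  moreover have "\<exists>x\<in>M. \<exists>y\<in>M. real n \<le> e x y" for n
  proof -
    obtain x where x: "x \<in> M" "n \<le> f x"
      using f(2) by blast
    \<comment> \<open>A strictly larger value of \<open>f\<close> ensures that \<open>g x y\<close>
      is not 0 but \<open>f y\<close>.\<close>
    obtain y where y: "y \<in> M" "Suc (f x) \<le> f y"
      using f(2) by blast
    have "real n \<le> e x y"
      using x(2) y(2) unfolding e_def g_def by auto
    then show ?thesis
      using x(1) y(1) by blast
  qed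
  ultimately show thesis
    using that E.Ultrametric_space_axioms by blast
qed

end

section \<open>The equivalence with compactness\<close>

text \<open>A complete multipartite graph has an edge, and an edge of the diametrical graph bounds
  all distances. Without compactness some compatible ultrametric is unbounded.\<close>

lemma compact_if_diametrical_graphs_complete_multipartite:
  assumes "ultrametrizable T"
    and "\<And>d. \<lbrakk>Ultrametric_space (topspace T) d; compatible T d\<rbrakk> \<Longrightarrow>
      complete_multipartite (diametrical_graph (topspace T) d)"
  shows "compact_space T"
proof (rule ccontr)
  assume nc: "\<not> compact_space T"
  obtain d where d: "Ultrametric_space (topspace T) d" "compatible T d"
    using assms(1) unfolding ultrametrizable_def by blast
  interpret Ultrametric_space "topspace T" d
    by fact
  have T: "T = mtopology"
    using d(2) compatible_iff by blast
  obtain e where e: "Ultrametric_space (topspace T) e"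
    "Metric_space.mtopology (topspace T) e = mtopology"
    "\<And>n::nat. \<exists>x\<in>topspace T. \<exists>y\<in>topspace T. real n \<le> e x y"
    using unbounded_ultrametric_if_not_compact nc T by metis
  interpret E: Ultrametric_space "topspace T" e
    by fact
  have "compatible T e"
    using E.compatible_iff e(2) T by metis
  then obtain u v where "{u, v} \<in> edges (diametrical_graph (topspace T) e)"
    using assms(2) e(1) complete_multipartite_edge by blast
  then have bound: "\<forall>x\<in>topspace T. \<forall>y\<in>topspace T. e x y \<le> e u v"
    unfolding E.diametrical_graph_edge_iff by blast
  obtain n :: nat where "e u v < real n"
    using reals_Archimedean2 by blast
  then show False
    using e(3)[of n] bound by fastforce
qed

lemma complete_partite_if_compact:
  assumes "compact_space T" "|{..<2::nat}| \<le>o |topspace T|"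
    and d: "Ultrametric_space (topspace T) d" "compatible T d"
  shows "\<exists>k::nat. complete_partite |{..<k}| (diametrical_graph (topspace T) d)"
proof -
  interpret Ultrametric_space "topspace T" d
    by fact
  have "T = mtopology"
    using d(2) compatible_iff by blast
  then have "mtotally_bounded (topspace T)"
    using assms(1) compact_space_eq_mcomplete_mtotally_bounded by metis
  then show ?thesis
    using complete_partite_diametrical_graph assms(2) unfolding two_le_card_iff by blast
qed

theorem corollary3p9:
  fixes T :: "'a topology"
  assumes "ultrametrizable T"
    and "|{..<2::nat}| \<le>o |topspace T|"
  shows "((\<forall>d. Ultrametric_space (topspace T) d \<and> compatible T d \<longrightarrow>
             (\<exists>k::nat. complete_partite |{..<k}| (diametrical_graph (topspace T) d)))
          \<longleftrightarrow> (\<forall>d. Ultrametric_space (topspace T) d \<and> compatible T d \<longrightarrow>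
             complete_multipartite (diametrical_graph (topspace T) d)))
       \<and> ((\<forall>d. Ultrametric_space (topspace T) d \<and> compatible T d \<longrightarrow>
             complete_multipartite (diametrical_graph (topspace T) d))
          \<longleftrightarrow> compact_space T)"
    (is "(?i \<longleftrightarrow> ?ii) \<and> (?ii \<longleftrightarrow> ?iii)")
proof -
  have "?i \<Longrightarrow> ?ii"
    by (blast intro: complete_partite_imp_multipartite)
  moreover have "?ii \<Longrightarrow> ?iii"
    using compact_if_diametrical_graphs_complete_multipartite[OF assms(1)] by blast
  moreover have "?iii \<Longrightarrow> ?i"
    using complete_partite_if_compact[OF _ assms(2)] by blast
  ultimately show ?thesis
    by argo
qed

end
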